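(* Let $L=\infty$ and let admissible data $(\Phi,\alpha,\beta)$ for the continuous-coupling case be given (as defined in the context). Suppose that $\Phi'''(0)>0$ and that $\operatorname{supp}\alpha\subset[0,\Xi]$ for some $0<\Xi<\infty$. Then for every $K>0$ (with $\mathcal{C}_K\neq\emptyset$) one has $$P(K)>Q(K).$$
   Context: For $\xi>0$ let $(\mathcal{A}_\xi W)(x):=\int_{x-\xi/2}^{x+\xi/2}W(\tilde x)\,d\tilde x$ for $W\in L^2(\mathbb{R})$. A function $\Phi:[0,\infty)\to[0,\infty)$ is called weakly super-quadratic if it is not identically zero and $\Phi(0)=\Phi'(0)=0$, $\Phi''(r)r\ge\Phi'(r)\ge0$ for all $r\ge0$. Admissible data for the continuous-coupling case: a weakly super-quadratic $\Phi$, three times continuously differentiable on $[0,\infty)$, and nonnegative measurable functions $\alpha,\beta$ on $(0,\infty)$ such that for all $K>0$ $$\int_0^\infty(\xi+\xi^2)\,\alpha(\xi)\beta(\xi)^2\,\phi\big(\xi^{1/2}\beta(\xi)\sqrt{2K}\big)\,d\xi<\infty,\qquad \phi(r):=r^{-1}|\Phi'(r)|,\ \phi(0):=\Phi''(0).$$ One sets $$\mathcal{P}(W)=\int_0^\infty\int_{\mathbb{R}}\alpha(\xi)\Phi(\beta(\xi)\mathcal{A}_\xi W)\,dx\,d\xi,\qquad \mathcal{Q}(W)=\tfrac12\Phi''(0)\int_0^\infty\alpha(\xi)\beta(\xi)^2\int_{\mathbb{R}}(\mathcal{A}_\xi W)^2dx\,d\xi.$$ $\mathcal{C}$ is the closure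 in $L^2(\mathbb{R})$ of the set of all $W\in C_c^\infty(\mathbb{R})$ with $W(x)=W(-x)\ge0$ and $-W'(x)=W'(-x)\ge0$ for all $x\ge0$ (even, nonnegative, unimodal functions). Put $\mathcal{K}(W)=\tfrac12\|W\|_2^2$ and $\mathcal{C}_K=\{W\in\mathcal{C}:\mathcal{P}(W)>0,\ \mathcal{K}(W)=K\}$, $P(K)=\sup\{\mathcal{P}(W):W\in\mathcal{C}_K\}$, $Q(K)=\sup\{\mathcal{Q}(W):W\in\mathcal{C}_K\}$. *)

theory Defs
  imports "HOL-Analysis.Analysis"
begin

text \<open>
  Elements of \<open>L\<^sup>2(\<real>)\<close> are represented by square-integrable, Lebesgue measurable functions
  \<open>real \<Rightarrow> real\<close>; every functional below depends only on the class modulo null sets.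
\<close>

definition L2 :: "(real \<Rightarrow> real) set" where
  "L2 = {W. W \<in> borel_measurable lebesgue \<and> integrable lebesgue (\<lambda>x. (W x)\<^sup>2)}"

definition L2_norm :: "(real \<Rightarrow> real) \<Rightarrow> real" where
  "L2_norm W = sqrt (LINT x|lebesgue. (W x)\<^sup>2)"

text \<open>
  Derivatives on the half-line \<open>[0,\<infinity>)\<close>, one-sided at \<open>0\<close>. At negative points the value is
  meaningless and never used.
\<close>

definition hderiv :: "(real \<Rightarrow> real) \<Rightarrow> real \<Rightarrow> real" where
  "hderiv f r = vector_derivative f (at r within {0..})"

definition C3_halfline :: "(real \<Rightarrow> real) \<Rightarrow> bool" where
  "C3_halfline \<Phi> \<longleftrightarrow>
     (\<forall>n<3. (hderiv ^^ n) \<Phi> differentiable_on {0..}) \<and> continuous_on {0..} ((hderiv ^^ 3) \<Phi>)"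

definition weakly_super_quadratic :: "(real \<Rightarrow> real) \<Rightarrow> bool" where
  "weakly_super_quadratic \<Phi> \<longleftrightarrow>
     (\<forall>r\<ge>0. 0 \<le> \<Phi> r) \<and> (\<exists>r\<ge>0. \<Phi> r \<noteq> 0) \<and>
     \<Phi> 0 = 0 \<and> hderiv \<Phi> 0 = 0 \<and>
     (\<forall>r\<ge>0. (hderiv ^^ 2) \<Phi> r * r \<ge> hderiv \<Phi> r \<and> hderiv \<Phi> r \<ge> 0)"

definition small_phi :: "(real \<Rightarrow> real) \<Rightarrow> real \<Rightarrow> real" where
  "small_phi \<Phi> r = (if r = 0 then (hderiv ^^ 2) \<Phi> 0 else inverse r * \<bar>hderiv \<Phi> r\<bar>)"

definition admissible :: "(real \<Rightarrow> real) \<Rightarrow> (real \<Rightarrow> real) \<Rightarrow> (real \<Rightarrow> real) \<Rightarrow> bool" where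
  "admissible \<Phi> \<alpha> \<beta> \<longleftrightarrow>
     weakly_super_quadratic \<Phi> \<and> C3_halfline \<Phi> \<and>
     \<alpha> \<in> borel_measurable (lebesgue_on {0<..}) \<and> (\<forall>\<xi>>0. 0 \<le> \<alpha> \<xi>) \<and>
     \<beta> \<in> borel_measurable (lebesgue_on {0<..}) \<and> (\<forall>\<xi>>0. 0 \<le> \<beta> \<xi>) \<and>
     (\<forall>K>0. (\<integral>\<^sup>+\<xi>. ennreal ((\<xi> + \<xi>\<^sup>2) * \<alpha> \<xi> * (\<beta> \<xi>)\<^sup>2 *
                small_phi \<Phi> (sqrt \<xi> * \<beta> \<xi> * sqrt (2 * K))) \<partial>lebesgue_on {0<..}) < \<infinity>)"

text \<open>
  Essential support of a function given on \<open>S\<close>: the complement of the largest open set on which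
  it vanishes almost everywhere. It is contained in the closure of \<open>{x \<in> S. f x \<noteq> 0}\<close>.
\<close>

definition ess_support :: "real set \<Rightarrow> (real \<Rightarrow> real) \<Rightarrow> real set" where
  "ess_support S f = {x. \<forall>e>0. \<not> (AE y in lebesgue_on S. y \<in> ball x e \<longrightarrow> f y = 0)}"

definition \<A> :: "real \<Rightarrow> (real \<Rightarrow> real) \<Rightarrow> real \<Rightarrow> real" where
  "\<A> \<xi> W x = (LINT y:{x - \<xi>/2..x + \<xi>/2}|lebesgue. W y)"

text \<open>
  The integrands are nonnegative (for \<open>\<P>\<close>: on functions that are nonnegative almost everywhere,
  in particular on the cone \<open>\<C>\<close>), so both functionals take values in \<open>[0,\<infinity>]\<close>.
\<close>

definition \<P> :: "(real \<Rightarrow> real) \<Rightarrow> (real \<Rightarrow> real) \<Rightarrow> (real \<Rightarrow> real) \<Rightarrow> (real \<Rightarrow> real) \<Rightarrow> ennreal" where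
  "\<P> \<Phi> \<alpha> \<beta> W =
     (\<integral>\<^sup>+\<xi>. (\<integral>\<^sup>+x. ennreal (\<alpha> \<xi> * \<Phi> (\<beta> \<xi> * \<A> \<xi> W x)) \<partial>lebesgue) \<partial>lebesgue_on {0<..})"

definition \<Q> :: "(real \<Rightarrow> real) \<Rightarrow> (real \<Rightarrow> real) \<Rightarrow> (real \<Rightarrow> real) \<Rightarrow> (real \<Rightarrow> real) \<Rightarrow> ennreal" where
  "\<Q> \<Phi> \<alpha> \<beta> W = ennreal (1/2 * (hderiv ^^ 2) \<Phi> 0) *
     (\<integral>\<^sup>+\<xi>. ennreal (\<alpha> \<xi> * (\<beta> \<xi>)\<^sup>2) * (\<integral>\<^sup>+x. ennreal ((\<A> \<xi> W x)\<^sup>2) \<partial>lebesgue) \<partial>lebesgue_on {0<..})"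

definition Cc_infinity :: "(real \<Rightarrow> real) set" where
  "Cc_infinity = {W. (\<forall>n x. (deriv ^^ n) W field_differentiable at x) \<and> compact (closure {x. W x \<noteq> 0})}"

definition smooth_unimodal :: "(real \<Rightarrow> real) set" where
  "smooth_unimodal = {W \<in> Cc_infinity. \<forall>x\<ge>0. W x = W (- x) \<and> W (- x) \<ge> 0 \<and>
      - deriv W x = deriv W (- x) \<and> deriv W (- x) \<ge> 0}"

definition \<C> :: "(real \<Rightarrow> real) set" where
  "\<C> = {W \<in> L2. \<forall>e>0. \<exists>V\<in>smooth_unimodal. L2_norm (\<lambda>x. W x - V x) < e}"

definition \<K> :: "(real \<Rightarrow> real) \<Rightarrow> real" where
  "\<K> W = 1/2 * (L2_norm W)\<^sup>2"

definition \<C>_energy :: "(real \<Rightarrow> real) \<Rightarrow> (real \<Rightarrow> real) \<Rightarrow> (real \<Rightarrow> real) \<Rightarrow> real \<Rightarrow> (real \<Rightarrow> real) set" where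
  "\<C>_energy \<Phi> \<alpha> \<beta> K = {W \<in> \<C>. \<P> \<Phi> \<alpha> \<beta> W > 0 \<and> \<K> W = K}"

definition P_sup :: "(real \<Rightarrow> real) \<Rightarrow> (real \<Rightarrow> real) \<Rightarrow> (real \<Rightarrow> real) \<Rightarrow> real \<Rightarrow> ennreal" where
  "P_sup \<Phi> \<alpha> \<beta> K = (SUP W\<in>\<C>_energy \<Phi> \<alpha> \<beta> K. \<P> \<Phi> \<alpha> \<beta> W)"

definition Q_sup :: "(real \<Rightarrow> real) \<Rightarrow> (real \<Rightarrow> real) \<Rightarrow> (real \<Rightarrow> real) \<Rightarrow> real \<Rightarrow> ennreal" where
  "Q_sup \<Phi> \<alpha> \<beta> K = (SUP W\<in>\<C>_energy \<Phi> \<alpha> \<beta> K. \<Q> \<Phi> \<alpha> \<beta> W)"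

end

theory Submission
  imports Defs
begin

text \<open>
  Write \<open>c2 = \<Phi>''(0)\<close>, \<open>c3 = \<Phi>'''(0)\<close> and \<open>A = \<integral>\<alpha>\<beta>\<^sup>2\<xi>\<^sup>2 d\<xi>\<close>. Each averaging operator \<open>\<A> \<xi>\<close> has norm at most
  \<open>\<xi>\<close> on square-integrable functions (\<open>averaging_L2_bound\<close>), so the quadratic functional is at most
  \<open>c2 K A\<close> on the energy sphere (\<open>Q_le\<close>). This bound is approached by wide, flat profiles, which the
  averages hardly change apart from the factor \<open>\<xi>\<close>. It is thus enough to find one profile in the
  cone whose full energy exceeds \<open>c2 K A\<close>.

  Such a profile is already a symmetric step of height \<open>h\<close> on \<open>[-L,L]\<close>, normalised by \<open>h\<^sup>2 L = K\<close>, with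
  \<open>h\<close> small. Its average over windows of length \<open>\<xi>\<close> is the constant \<open>h\<xi>\<close> except in boundary layers of
  width at most \<open>\<Xi>\<close>, because \<open>\<alpha>\<close> lives on \<open>[0,\<Xi>]\<close>. Discarding these layers costs a relative amount of
  order \<open>\<Xi>/L\<close>, that is of order \<open>h\<^sup>2\<close>, of the quadratic energy. On the other hand super-quadraticity
  gives \<open>\<Phi> r \<ge> c2/2 r\<^sup>2\<close> everywhere (\<open>Phi_ge_quadratic\<close>), and \<open>c3 > 0\<close> adds a term of order \<open>r\<^sup>3\<close> near
  zero (\<open>Phi_ge_cubic_near_zero\<close>); as the arguments of \<open>\<Phi>\<close> are proportional to \<open>h\<close>, this gain is of
  relative order \<open>h\<close>. For small \<open>h\<close> the gain beats the loss.

  That a discontinuous step belongs to the closed cone is seen by approximating it with the smooth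
  unimodal functions \<open>h exp(-\<epsilon>/(L\<^sup>2 - x\<^sup>2))\<close>, extended by zero, as \<open>\<epsilon>\<close> tends to \<open>0\<close>
  (\<open>step_in_closed_cone\<close>). If \<open>c2 = 0\<close>, the quadratic functional vanishes, whereas every
  member of the energy sphere has positive full energy.
\<close>

section \<open>Lower bounds for super-quadratic functions\<close>

lemma hderiv_within_halfline:
  assumes "f differentiable_on {0..}" and "0 \<le> r"
  shows "(f has_real_derivative hderiv f r) (at r within {0..})"
proof -
  have "f differentiable (at r within {0..})"
    using assms by (auto simp: differentiable_on_def)
  then have "(f has_vector_derivative hderiv f r) (at r within {0..})"
    unfolding hderiv_def vector_derivative_works .
  then show ?thesis
    by (simp add: has_real_derivative_iff_has_vector_derivative)
qed

lemma le_if_halfline_deriv_le: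
  fixes f g :: "real \<Rightarrow> real"
  assumes "0 \<le> a" "a \<le> b"
    and f: "\<And>x. a \<le> x \<Longrightarrow> x \<le> b \<Longrightarrow> (f has_real_derivative f' x) (at x within {0..})"
    and g: "\<And>x. a \<le> x \<Longrightarrow> x \<le> b \<Longrightarrow> (g has_real_derivative g' x) (at x within {0..})"
    and le: "\<And>x. a < x \<Longrightarrow> x < b \<Longrightarrow> f' x \<le> g' x"
    and "f a \<le> g a"
  shows "f b \<le> g b"
proof -
  have D: "((\<lambda>x. g x - f x) has_real_derivative g' x - f' x) (at x within {0..})"
    if "a \<le> x" "x \<le> b" for x
    using f g that by (intro derivative_intros) auto
  have "g a - f a \<le> g b - f b"
  proof (rule DERIV_nonneg_imp_increasing_open[OF \<open>a \<le> b\<close>])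
    fix x assume x: "a < x" "x < b"
    then have "x \<in> interior {0..}" using \<open>0 \<le> a\<close> by simp
    then have "at x within {0..} = at x" by (rule at_within_interior)
    then show "\<exists>y. ((\<lambda>x. g x - f x) has_real_derivative y) (at x) \<and> 0 \<le> y"
      using D[of x] le[of x] x by (intro exI[of _ "g' x - f' x"]) auto
  next
    have "continuous (at x within {a..b}) (\<lambda>x. g x - f x)" if "x \<in> {a..b}" for x
      using DERIV_continuous[OF D[of x]] that \<open>0 \<le> a\<close>
      by (auto intro: continuous_within_subset)
    then show "continuous_on {a..b} (\<lambda>x. g x - f x)"
      by (simp add: continuous_on_eq_continuous_within)
  qed
  then show ?thesis using \<open>f a \<le> g a\<close> by simp
qed

context
  fixes \<Phi> :: "real \<Rightarrow> real"
  assumes wsq: "weakly_super_quadratic \<Phi>" and C3: "C3_halfline \<Phi>"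
begin

lemma has_deriv_Phi:
  assumes "0 \<le> r"
  shows "(\<Phi> has_real_derivative hderiv \<Phi> r) (at r within {0..})"
    and "(hderiv \<Phi> has_real_derivative (hderiv ^^ 2) \<Phi> r) (at r within {0..})"
    and "((hderiv ^^ 2) \<Phi> has_real_derivative (hderiv ^^ 3) \<Phi> r) (at r within {0..})"
proof -
  have D: "(hderiv ^^ n) \<Phi> differentiable_on {0..}" if "n < 3" for n
    using C3 that by (auto simp: C3_halfline_def)
  have "((hderiv ^^ n) \<Phi> has_real_derivative (hderiv ^^ Suc n) \<Phi> r) (at r within {0..})"
    if "n < 3" for n
    using hderiv_within_halfline[OF D[OF that] assms] by simp
  from this[of 0] this[of 1] this[of 2]
  show "(\<Phi> has_real_derivative hderiv \<Phi> r) (at r within {0..})"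
    and "(hderiv \<Phi> has_real_derivative (hderiv ^^ 2) \<Phi> r) (at r within {0..})"
    and "((hderiv ^^ 2) \<Phi> has_real_derivative (hderiv ^^ 3) \<Phi> r) (at r within {0..})"
    by (simp_all add: numeral_2_eq_2 numeral_3_eq_3)
qed

lemma Phi_zero: "\<Phi> 0 = 0" "hderiv \<Phi> 0 = 0"
  using wsq by (auto simp: weakly_super_quadratic_def)

text \<open>
  The condition \<open>\<Phi>'' r \<ge> \<Phi>'\<close> says exactly that \<open>\<Phi>'(r)/r\<close> is nondecreasing on \<open>(0,\<infinity>)\<close>, and the
  limit of this quotient at \<open>0\<close> is \<open>\<Phi>''(0)\<close> because \<open>\<Phi>'(0) = 0\<close>.
\<close>

lemma deriv_Phi_ge_linear:
  assumes "0 \<le> r"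
  shows "(hderiv ^^ 2) \<Phi> 0 * r \<le> hderiv \<Phi> r"
proof (cases "r = 0")
  case False
  then have "0 < r" using assms by simp
  have quot_mono: "hderiv \<Phi> s / s \<le> hderiv \<Phi> r / r" if "0 < s" "s \<le> r" for s
  proof (rule DERIV_nonneg_imp_nondecreasing[OF \<open>s \<le> r\<close>])
    fix x assume "s \<le> x" "x \<le> r"
    then have "0 < x" using \<open>0 < s\<close> by simp
    then have "x \<in> interior {0..}" by simp
    then have "(hderiv \<Phi> has_real_derivative (hderiv ^^ 2) \<Phi> x) (at x)"
      using has_deriv_Phi(2)[of x] \<open>0 < x\<close> at_within_interior[of x "{0..}"] by simp
    then have "((\<lambda>x. hderiv \<Phi> x / x) has_real_derivative
        ((hderiv ^^ 2) \<Phi> x * x - hderiv \<Phi> x) / (x * x)) (at x)"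
      using \<open>0 < x\<close> by (auto intro!: derivative_eq_intros simp: field_simps)
    moreover have "hderiv \<Phi> x \<le> (hderiv ^^ 2) \<Phi> x * x"
      using wsq \<open>0 < x\<close> by (auto simp: weakly_super_quadratic_def)
    ultimately show "\<exists>y. ((\<lambda>x. hderiv \<Phi> x / x) has_real_derivative y) (at x) \<and> 0 \<le> y"
      using \<open>0 < x\<close> by (intro exI conjI) auto
  qed
  have "((\<lambda>s. hderiv \<Phi> s / s) \<longlongrightarrow> (hderiv ^^ 2) \<Phi> 0) (at 0 within {0..})"
    using has_deriv_Phi(2)[of 0] Phi_zero by (simp add: has_field_derivative_iff)
  moreover have "\<forall>\<^sub>F s in at 0 within {0..}. hderiv \<Phi> s / s \<le> hderiv \<Phi> r / r"
    unfolding eventually_at using \<open>0 < r\<close> quot_mono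
    by (intro exI[of _ r]) (auto simp: dist_real_def)
  moreover have "at (0::real) within {0..} \<noteq> bot"
    by (metis at_within_Ici_at_right trivial_limit_at_right_real)
  ultimately have "(hderiv ^^ 2) \<Phi> 0 \<le> hderiv \<Phi> r / r"
    by (intro tendsto_upperbound)
  then show ?thesis using \<open>0 < r\<close> by (simp add: field_simps)
qed (simp add: Phi_zero)

lemma Phi_ge_quadratic:
  assumes "0 \<le> r"
  shows "(hderiv ^^ 2) \<Phi> 0 / 2 * r\<^sup>2 \<le> \<Phi> r"
proof (rule le_if_halfline_deriv_le[of 0 r "\<lambda>r. (hderiv ^^ 2) \<Phi> 0 / 2 * r\<^sup>2"
      "\<lambda>r. (hderiv ^^ 2) \<Phi> 0 * r" \<Phi> "hderiv \<Phi>"])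
  fix x :: real assume "0 \<le> x"
  then show "(\<Phi> has_real_derivative hderiv \<Phi> x) (at x within {0..})"
    by (rule has_deriv_Phi)
qed (use assms deriv_Phi_ge_linear in \<open>auto intro!: derivative_eq_intros simp: Phi_zero\<close>)

text \<open>
  Hence the integrability hypothesis on the data controls \<open>\<integral>\<xi>\<^sup>2\<alpha>\<beta>\<^sup>2\<close> when \<open>\<Phi>''(0) > 0\<close>.
\<close>

lemma small_phi_ge:
  assumes "0 \<le> r"
  shows "(hderiv ^^ 2) \<Phi> 0 \<le> small_phi \<Phi> r"
  using deriv_Phi_ge_linear[OF assms] assms
  by (auto simp: small_phi_def field_simps)

text \<open>
  By continuity the third derivative is at least \<open>\<Phi>'''(0)/2\<close> near \<open>0\<close>; three integrations turn this
  into the cubic term with coefficient \<open>\<Phi>'''(0)/12\<close>.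
\<close>

lemma Phi_ge_cubic_near_zero:
  assumes "0 < (hderiv ^^ 3) \<Phi> 0"
  obtains r0 where "0 < r0"
    and "\<And>r. 0 \<le> r \<Longrightarrow> r \<le> r0 \<Longrightarrow>
      (hderiv ^^ 2) \<Phi> 0 / 2 * r\<^sup>2 + (hderiv ^^ 3) \<Phi> 0 / 12 * r ^ 3 \<le> \<Phi> r"
proof -
  define c2 c3 where "c2 = (hderiv ^^ 2) \<Phi> 0" and "c3 = (hderiv ^^ 3) \<Phi> 0"
  have "0 < c3" using assms by (simp add: c3_def)
  have "continuous_on {0..} ((hderiv ^^ 3) \<Phi>)" using C3 by (simp add: C3_halfline_def)
  then obtain d where "d > 0"
    and d: "\<And>x. 0 \<le> x \<Longrightarrow> \<bar>x\<bar> < d \<Longrightarrow> \<bar>(hderiv ^^ 3) \<Phi> x - c3\<bar> < c3 / 2"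
    unfolding continuous_on_iff using \<open>0 < c3\<close>
    by (metis atLeast_iff c3_def diff_zero dist_real_def half_gt_zero order_refl)
  have third: "c3 / 2 \<le> (hderiv ^^ 3) \<Phi> x" if "0 \<le> x" "x \<le> d / 2" for x
    using d[of x] that \<open>d > 0\<close> by linarith
  have second: "c2 + c3 / 2 * r \<le> (hderiv ^^ 2) \<Phi> r" if "0 \<le> r" "r \<le> d / 2" for r
    by (rule le_if_halfline_deriv_le[of 0 r "\<lambda>x. c2 + c3 / 2 * x" "\<lambda>x. c3 / 2"
          "(hderiv ^^ 2) \<Phi>" "(hderiv ^^ 3) \<Phi>", OF _ _ _ has_deriv_Phi(3) third])
      (use that in \<open>auto intro!: derivative_eq_intros simp: c2_def\<close>)
  have first: "c2 * r + c3 / 4 * r\<^sup>2 \<le> hderiv \<Phi> r" if "0 \<le> r" "r \<le> d / 2" for r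
    by (rule le_if_halfline_deriv_le[of 0 r "\<lambda>x. c2 * x + c3 / 4 * x\<^sup>2" "\<lambda>x. c2 + c3 / 2 * x"
          "hderiv \<Phi>" "(hderiv ^^ 2) \<Phi>", OF _ _ _ has_deriv_Phi(2) second])
      (use that in \<open>auto intro!: derivative_eq_intros simp: Phi_zero\<close>)
  have "c2 / 2 * r\<^sup>2 + c3 / 12 * r ^ 3 \<le> \<Phi> r" if "0 \<le> r" "r \<le> d / 2" for r
    by (rule le_if_halfline_deriv_le[of 0 r "\<lambda>x. c2 / 2 * x\<^sup>2 + c3 / 12 * x ^ 3"
          "\<lambda>x. c2 * x + c3 / 4 * x\<^sup>2" \<Phi> "hderiv \<Phi>", OF _ _ _ has_deriv_Phi(1) first])
      (use that in \<open>auto intro!: derivative_eq_intros simp: Phi_zero\<close>)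
  then show ?thesis using that[of "d / 2"] \<open>d > 0\<close> by (simp add: c2_def c3_def)
qed

end

section \<open>Smooth approximation of a symmetric step\<close>

text \<open>
  The smooth flat function \<open>exp(-\<epsilon>/t)\<close> for \<open>t > 0\<close>, divided by powers of \<open>t\<close>: the family in \<open>k\<close> is closed
  under differentiation up to linear combinations.
\<close>

definition flat_exp :: "real \<Rightarrow> nat \<Rightarrow> real \<Rightarrow> real" where
  "flat_exp \<epsilon> k t = (if 0 < t then exp (- (\<epsilon> / t)) * inverse t ^ k else 0)"

text \<open>
  The only delicate point is \<open>t = 0\<close>: the substitution \<open>y = \<epsilon>/t\<close> turns the difference quotient into a
  multiple of \<open>y ^ (k + 1) / exp y\<close>, which tends to \<open>0\<close> as \<open>y\<close> grows.
\<close>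

lemma flat_exp_has_derivative:
  assumes "0 < \<epsilon>"
  shows "(flat_exp \<epsilon> k has_real_derivative
    \<epsilon> * flat_exp \<epsilon> (k + 2) t - real k * flat_exp \<epsilon> (k + 1) t) (at t)"
proof -
  consider "t < 0" | "t = 0" | "0 < t" by linarith
  then show ?thesis
  proof cases
    case 1
    have "((\<lambda>t. 0) has_real_derivative 0) (at t)" by simp
    then have "(flat_exp \<epsilon> k has_real_derivative 0) (at t)"
      by (rule DERIV_cong_ev[THEN iffD1, OF refl _ refl, rotated])
        (use eventually_nhds_in_open[of "{..<0}" t] 1 in
          \<open>auto elim!: eventually_mono simp: flat_exp_def\<close>)
    then show ?thesis using 1 by (simp add: flat_exp_def)
  next
    case 3
    have "((\<lambda>t. inverse t ^ k) has_real_derivative - (real k * inverse t ^ (k + 1))) (at t)"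
    proof (cases k)
      case (Suc n)
      have "((\<lambda>t. inverse t ^ k) has_real_derivative
          real k * (- (inverse t ^ Suc (Suc 0)) * inverse t ^ (k - Suc 0))) (at t)"
        using 3 by (intro DERIV_power DERIV_inverse) auto
      then show ?thesis by (simp add: Suc mult_ac)
    qed simp
    moreover have "((\<lambda>t. exp (- (\<epsilon> / t))) has_real_derivative
        exp (- (\<epsilon> / t)) * (\<epsilon> * inverse t ^ 2)) (at t)"
      using 3 by (auto intro!: derivative_eq_intros simp: power2_eq_square field_simps)
    ultimately have "((\<lambda>t. exp (- (\<epsilon> / t)) * inverse t ^ k) has_real_derivative
        exp (- (\<epsilon> / t)) * (\<epsilon> * inverse t ^ 2) * inverse t ^ k
        + - (real k * inverse t ^ (k + 1)) * exp (- (\<epsilon> / t))) (at t)"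
      by (intro DERIV_mult)
    also have "exp (- (\<epsilon> / t)) * (\<epsilon> * inverse t ^ 2) * inverse t ^ k
        + - (real k * inverse t ^ (k + 1)) * exp (- (\<epsilon> / t))
        = \<epsilon> * flat_exp \<epsilon> (k + 2) t - real k * flat_exp \<epsilon> (k + 1) t"
      using 3 by (simp add: flat_exp_def power2_eq_square algebra_simps)
    finally have "((\<lambda>t. exp (- (\<epsilon> / t)) * inverse t ^ k) has_real_derivative
        \<epsilon> * flat_exp \<epsilon> (k + 2) t - real k * flat_exp \<epsilon> (k + 1) t) (at t)" .
    then show ?thesis
      by (rule DERIV_cong_ev[THEN iffD1, OF refl _ refl, rotated])
        (use eventually_nhds_in_open[of "{0<..}" t] 3 in
          \<open>auto elim!: eventually_mono simp: flat_exp_def\<close>)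
  next
    case 2
    have "filterlim (\<lambda>h. \<epsilon> * inverse h) at_top (at_right (0::real))"
      using assms filterlim_inverse_at_top_right
      by (intro filterlim_tendsto_pos_mult_at_top[OF tendsto_const]) auto
    then have "((\<lambda>h. (\<epsilon> * inverse h) ^ (k + 1) / exp (\<epsilon> * inverse h)) \<longlongrightarrow> 0) (at_right 0)"
      by (rule filterlim_compose[OF tendsto_power_div_exp_0])
    then have "((\<lambda>h. (\<epsilon> * inverse h) ^ (k + 1) / exp (\<epsilon> * inverse h) / \<epsilon> ^ (k + 1))
        \<longlongrightarrow> 0 / \<epsilon> ^ (k + 1)) (at_right 0)"
      using assms by (intro tendsto_intros) auto
    moreover have "\<forall>\<^sub>F h in at_right 0. (\<epsilon> * inverse h) ^ (k + 1) / exp (\<epsilon> * inverse h) / \<epsilon> ^ (k + 1)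
        = flat_exp \<epsilon> k h / h"
      using eventually_at_right_less[of 0]
    proof eventually_elim
      case (elim h)
      have "(\<epsilon> * inverse h) ^ (k + 1) / exp (\<epsilon> * inverse h) / \<epsilon> ^ (k + 1)
          = inverse h ^ (k + 1) / exp (\<epsilon> * inverse h)"
        using assms by (simp add: power_mult_distrib)
      then show ?case using elim by (simp add: flat_exp_def exp_minus divide_inverse mult_ac)
    qed
    ultimately have "((\<lambda>h. flat_exp \<epsilon> k h / h) \<longlongrightarrow> 0 / \<epsilon> ^ (k + 1)) (at_right 0)"
      by (rule Lim_transform_eventually)
    then have R: "((\<lambda>h. flat_exp \<epsilon> k h / h) \<longlongrightarrow> 0) (at_right 0)" by simp
    have "((\<lambda>h. flat_exp \<epsilon> k h / h) \<longlongrightarrow> 0) (at_left 0)"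
      by (rule tendsto_eventually) (auto simp: eventually_at_filter flat_exp_def)
    with R have "((\<lambda>h. flat_exp \<epsilon> k h / h) \<longlongrightarrow> 0) (at 0)"
      by (simp add: filterlim_at_split)
    then show ?thesis using 2
      by (simp add: has_field_derivative_iff flat_exp_def)
  qed
qed

text \<open>
  The approximants of a step are the members with \<open>k = 0\<close> and constant \<open>p\<close>. The polynomial factor and
  the exponent \<open>k\<close> are there so that the derivative of a member is again a single member, which makes
  smoothness an induction on the order of differentiation.
\<close>

definition soft_step :: "real \<Rightarrow> real \<Rightarrow> real poly \<Rightarrow> nat \<Rightarrow> real \<Rightarrow> real" where
  "soft_step L \<epsilon> p k x = poly p x * flat_exp \<epsilon> k (L\<^sup>2 - x\<^sup>2)"

text \<open>
  The three terms of the derivative carry the exponents \<open>k\<close>, \<open>k + 1\<close> and \<open>k + 2\<close>; lower exponents are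
  raised to \<open>k + 2\<close> by multiplying with powers of the polynomial \<open>L\<^sup>2 - x\<^sup>2\<close>.
\<close>

lemma soft_step_has_derivative:
  assumes "0 < \<epsilon>"
  shows "\<exists>q. (\<forall>x. (soft_step L \<epsilon> p k has_real_derivative soft_step L \<epsilon> q (k + 2) x) (at x))"
proof (intro exI allI)
  fix x
  define q where "q = [:L\<^sup>2, 0, -1:]"
  have q: "poly q x = L\<^sup>2 - x\<^sup>2" for x by (simp add: q_def power2_eq_square)
  have lift: "flat_exp \<epsilon> k t = t ^ 2 * flat_exp \<epsilon> (k + 2) t"
    "flat_exp \<epsilon> (k + 1) t = t * flat_exp \<epsilon> (k + 2) t" for t
    by (auto simp: flat_exp_def power2_eq_square field_simps)
  have "((\<lambda>x. flat_exp \<epsilon> k (L\<^sup>2 - x\<^sup>2)) has_real_derivative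
      (\<epsilon> * flat_exp \<epsilon> (k + 2) (L\<^sup>2 - x\<^sup>2) - real k * flat_exp \<epsilon> (k + 1) (L\<^sup>2 - x\<^sup>2)) * (- 2 * x))
      (at x)"
    by (rule DERIV_chain2[OF flat_exp_has_derivative[OF assms]])
      (auto intro!: derivative_eq_intros)
  then have "((\<lambda>x. poly p x * flat_exp \<epsilon> k (L\<^sup>2 - x\<^sup>2)) has_real_derivative
      poly p x * ((\<epsilon> * flat_exp \<epsilon> (k + 2) (L\<^sup>2 - x\<^sup>2)
        - real k * flat_exp \<epsilon> (k + 1) (L\<^sup>2 - x\<^sup>2)) * (- 2 * x))
      + poly (pderiv p) x * flat_exp \<epsilon> k (L\<^sup>2 - x\<^sup>2)) (at x)"
    using poly_DERIV[of p x] by (intro DERIV_mult') 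
  moreover have "poly p x * ((\<epsilon> * flat_exp \<epsilon> (k + 2) (L\<^sup>2 - x\<^sup>2)
        - real k * flat_exp \<epsilon> (k + 1) (L\<^sup>2 - x\<^sup>2)) * (- 2 * x))
      + poly (pderiv p) x * flat_exp \<epsilon> k (L\<^sup>2 - x\<^sup>2)
     = soft_step L \<epsilon> (p * [:0, -2:] * ([:\<epsilon>:] - smult (real k) q) + pderiv p * q ^ 2) (k + 2) x"
    unfolding soft_step_def lift q by (simp add: q algebra_simps)
  ultimately show "(soft_step L \<epsilon> p k has_real_derivative
      soft_step L \<epsilon> (p * [:0, -2:] * ([:\<epsilon>:] - smult (real k) [:L\<^sup>2, 0, -1:])
        + pderiv p * [:L\<^sup>2, 0, -1:] ^ 2) (k + 2) x) (at x)"
    by (simp add: soft_step_def[abs_def] q_def)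
qed

lemma soft_step_iterated_deriv:
  assumes "0 < \<epsilon>"
  shows "\<exists>q j. (deriv ^^ n) (soft_step L \<epsilon> p k) = soft_step L \<epsilon> q j"
proof (induction n)
  case (Suc n)
  then obtain q j where "(deriv ^^ n) (soft_step L \<epsilon> p k) = soft_step L \<epsilon> q j" by blast
  moreover obtain q' where
    "\<And>x. (soft_step L \<epsilon> q j has_real_derivative soft_step L \<epsilon> q' (j + 2) x) (at x)"
    using soft_step_has_derivative[OF assms] by blast
  then have "deriv (soft_step L \<epsilon> q j) = soft_step L \<epsilon> q' (j + 2)"
    by (intro ext DERIV_imp_deriv)
  ultimately show ?case by auto
qed auto

text \<open>
  Being a function of \<open>x\<^sup>2\<close> gives evenness; unimodality holds since \<open>exp(-\<epsilon>/t)\<close> increases in \<open>t\<close>.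
\<close>

lemma soft_step_smooth_unimodal:
  assumes "0 < \<epsilon>" "0 < L" "0 \<le> h"
  shows "soft_step L \<epsilon> [:h:] 0 \<in> smooth_unimodal"
proof -
  let ?V = "soft_step L \<epsilon> [:h:] 0"
  have nonzero: "\<bar>x\<bar> \<le> L" if "?V x \<noteq> 0" for x
  proof -
    have "x\<^sup>2 < L\<^sup>2" using that by (auto simp: soft_step_def flat_exp_def split: if_splits)
    then show ?thesis using assms(2) abs_le_square_iff[of x L] by simp
  qed
  have "closure {x. ?V x \<noteq> 0} \<subseteq> {-L..L}"
    by (rule closure_minimal) (use nonzero in \<open>auto simp: abs_le_iff\<close>, force)
  then have "compact (closure {x. ?V x \<noteq> 0})"
    by (meson closed_closure compact_Icc compact_eq_bounded_closed bounded_subset)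
  moreover have "(deriv ^^ n) ?V field_differentiable at x" for n x
    using soft_step_iterated_deriv[OF assms(1), of n L "[:h:]" 0]
      soft_step_has_derivative[OF assms(1)]
    by (metis field_differentiable_def)
  ultimately have "?V \<in> Cc_infinity" by (simp add: Cc_infinity_def)
  moreover have dV: "deriv ?V x = - 2 * x * (h * \<epsilon> * flat_exp \<epsilon> 2 (L\<^sup>2 - x\<^sup>2))" for x
  proof (rule DERIV_imp_deriv)
    have "((\<lambda>x. flat_exp \<epsilon> 0 (L\<^sup>2 - x\<^sup>2)) has_real_derivative
      (\<epsilon> * flat_exp \<epsilon> 2 (L\<^sup>2 - x\<^sup>2)) * (- 2 * x)) (at x)"
    proof (rule DERIV_chain2[where f = "flat_exp \<epsilon> 0"])
      show "(flat_exp \<epsilon> 0 has_real_derivative \<epsilon> * flat_exp \<epsilon> 2 (L\<^sup>2 - x\<^sup>2)) (at (L\<^sup>2 - x\<^sup>2))"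
        using flat_exp_has_derivative[OF assms(1), of 0 "L\<^sup>2 - x\<^sup>2"] by (simp add: numeral_2_eq_2)
    qed (auto intro!: derivative_eq_intros)
    from DERIV_cmult[OF this, of h]
    show "(?V has_real_derivative - 2 * x * (h * \<epsilon> * flat_exp \<epsilon> 2 (L\<^sup>2 - x\<^sup>2))) (at x)"
      by (simp add: soft_step_def[abs_def] mult_ac)
  qed
  moreover have "0 \<le> flat_exp \<epsilon> k t" for k t by (simp add: flat_exp_def)
  ultimately show ?thesis
    using assms by (auto simp: smooth_unimodal_def soft_step_def)
qed

definition step :: "real \<Rightarrow> real \<Rightarrow> real \<Rightarrow> real" where
  "step h L x = h * indicat_real {-L..L} x"

lemma integral_step_squared:
  assumes "0 \<le> L"
  shows "integrable lebesgue (\<lambda>x. (step h L x)\<^sup>2)" "(LINT x|lebesgue. (step h L x)\<^sup>2) = 2 * L * h\<^sup>2"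
proof -
  have eq: "(step h L x)\<^sup>2 = h\<^sup>2 * indicat_real {-L..L} x" for x
    by (simp add: step_def indicator_def)
  show "integrable lebesgue (\<lambda>x. (step h L x)\<^sup>2)" "(LINT x|lebesgue. (step h L x)\<^sup>2) = 2 * L * h\<^sup>2"
    using assms by (auto simp: eq intro!: integrable_mult_right integrable_real_indicator)
qed

text \<open>
  As \<open>\<epsilon>\<close> tends to \<open>0\<close>, the approximants converge to \<open>h\<close> inside \<open>(-L,L)\<close> and vanish outside \<open>[-L,L]\<close>.
  They lie between \<open>0\<close> and the step itself, so dominated convergence gives convergence in norm.
\<close>

lemma step_in_closed_cone:
  assumes "0 < L" "0 \<le> h"
  shows "step h L \<in> \<C>"
proof -
  let ?V = "\<lambda>n. soft_step L (1 / real (Suc n)) [:h:] 0"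
  have L2: "step h L \<in> L2"
    using integral_step_squared[of L h] assms unfolding L2_def
    by (auto simp: step_def[abs_def] intro!: borel_measurable_times borel_measurable_indicator)
  have V: "?V n \<in> smooth_unimodal" for n
    using assms by (intro soft_step_smooth_unimodal) auto
  have [measurable]: "?V n \<in> borel_measurable lebesgue" for n
  proof -
    have "?V n field_differentiable at x" for x
      using V[of n] unfolding smooth_unimodal_def Cc_infinity_def
      by (metis (mono_tags, lifting) funpow_0 mem_Collect_eq)
    then have "continuous_on UNIV (?V n)"
      by (simp add: continuous_at_imp_continuous_on field_differentiable_imp_continuous_at)
    then show ?thesis
      by (intro measurable_completion) (simp add: borel_measurable_continuous_onI)
  qed
  have [measurable]: "step h L \<in> borel_measurable lebesgue" using L2 by (simp add: L2_def)
  have inside: "\<bar>x\<bar> \<le> L" if "x\<^sup>2 < L\<^sup>2" for x :: real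
    using that assms abs_le_square_iff[of x L] by simp
  have "(\<lambda>n. LINT x|lebesgue. (step h L x - ?V n x)\<^sup>2) \<longlonglongrightarrow> (LINT x|(lebesgue :: real measure). (0::real))"
  proof (rule integral_dominated_convergence[where w = "\<lambda>x. (step h L x)\<^sup>2"
        and f = "\<lambda>x. 0" and s = "\<lambda>n x. (step h L x - ?V n x)\<^sup>2"])
    show "AE x in lebesgue. (\<lambda>n. (step h L x - ?V n x)\<^sup>2) \<longlonglongrightarrow> 0"
    proof (rule AE_I'[of "{-L, L}"])
      show "{-L, L} \<in> null_sets lebesgue" by (auto intro!: null_sets_completionI finite_imp_null_set_lborel)
      show "{x \<in> space lebesgue. \<not> (\<lambda>n. (step h L x - ?V n x)\<^sup>2) \<longlonglongrightarrow> 0} \<subseteq> {-L, L}"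
      proof (rule subsetI, rule ccontr)
        fix x assume x: "x \<in> {x \<in> space lebesgue. \<not> (\<lambda>n. (step h L x - ?V n x)\<^sup>2) \<longlonglongrightarrow> 0}"
          and "x \<notin> {-L, L}"
        then consider "\<bar>x\<bar> < L" | "L < \<bar>x\<bar>" by fastforce
        then have "(\<lambda>n. (step h L x - ?V n x)\<^sup>2) \<longlonglongrightarrow> 0"
        proof cases
          case 1
          then have pos: "0 < L\<^sup>2 - x\<^sup>2" using power2_strict_mono[of x L] by simp
          have "(\<lambda>n. (h - h * exp (- (1 / real (Suc n) / (L\<^sup>2 - x\<^sup>2))))\<^sup>2)
              \<longlonglongrightarrow> (h - h * exp (- (0 / (L\<^sup>2 - x\<^sup>2))))\<^sup>2"
            using pos LIMSEQ_Suc[OF lim_1_over_n] by (intro tendsto_intros) auto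
          moreover have "x \<in> {-L..L}" using 1 by auto
          ultimately show ?thesis using pos by (simp add: step_def soft_step_def flat_exp_def)
        next
          case 2
          then have "\<not> 0 < L\<^sup>2 - x\<^sup>2" using power2_strict_mono[of L x] assms by simp
          moreover have "x \<notin> {-L..L}" using 2 by auto
          ultimately show ?thesis by (simp add: step_def soft_step_def flat_exp_def)
        qed
        with x show False by simp
      qed
    qed
    show "AE x in lebesgue. norm ((step h L x - ?V n x)\<^sup>2) \<le> (step h L x)\<^sup>2" for n
    proof (rule AE_I2)
      fix x
      have "0 \<le> ?V n x" using assms by (auto simp: soft_step_def flat_exp_def)
      moreover have "?V n x \<le> step h L x"
        using assms inside[of x]
        by (auto simp: soft_step_def flat_exp_def step_def indicator_def abs_le_iff
            intro!: mult_left_le)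
      ultimately show "norm ((step h L x - ?V n x)\<^sup>2) \<le> (step h L x)\<^sup>2"
        by (auto intro!: power_mono)
    qed
    show "integrable lebesgue (\<lambda>x. (step h L x)\<^sup>2)"
      using integral_step_squared[of L h] assms by simp
  qed measurable
  then have "(\<lambda>n. L2_norm (\<lambda>x. step h L x - ?V n x)) \<longlonglongrightarrow> sqrt 0"
    unfolding L2_norm_def by (intro tendsto_real_sqrt) simp
  then have lim: "(\<lambda>n. L2_norm (\<lambda>x. step h L x - ?V n x)) \<longlonglongrightarrow> 0" by simp
  have "\<exists>W\<in>smooth_unimodal. L2_norm (\<lambda>x. step h L x - W x) < e" if e: "e > 0" for e
  proof -
    obtain n where "L2_norm (\<lambda>x. step h L x - ?V n x) < e"
      using eventually_happens'[OF sequentially_bot order_tendstoD(2)[OF lim e]] by blast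
    then show ?thesis using V[of n] by blast
  qed
  then show ?thesis using L2 by (simp add: \<C>_def)
qed

section \<open>Averaging operators\<close>

text \<open>
  By the Cauchy-Schwarz inequality the square of a window average is at most \<open>\<xi>\<close> times the integral
  of \<open>W\<^sup>2\<close> over the window; integrating over the window centre and exchanging the integrals gives a
  second factor \<open>\<xi>\<close>.
\<close>

lemma averaging_L2_bound:
  assumes "W \<in> L2" "0 \<le> \<xi>"
  shows "(\<integral>\<^sup>+x. ennreal ((\<A> \<xi> W x)\<^sup>2) \<partial>lebesgue) \<le> ennreal (\<xi>\<^sup>2 * (L2_norm W)\<^sup>2)"
proof -
  have W: "W \<in> borel_measurable lebesgue" "integrable lebesgue (\<lambda>x. (W x)\<^sup>2)"
    using assms by (auto simp: L2_def)
  \<comment> \<open>A Borel representative, so that Tonelli's theorem applies on the product of Borel measures.\<close>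
  then obtain V where [measurable]: "V \<in> borel_measurable lborel" and "AE x in lborel. W x = V x"
    using completion_ex_borel_measurable_real by blast
  then have V: "AE x in lebesgue. W x = V x" by (intro AE_completion)
  \<comment> \<open>The kernel of the window average, symmetric in the window centre and the integration variable.\<close>
  define k :: "real \<Rightarrow> real \<Rightarrow> ennreal" where "k x y = (if \<bar>x - y\<bar> \<le> \<xi> / 2 then 1 else 0)" for x y
  have k_meas [measurable]: "(\<lambda>y. k x y) \<in> borel_measurable lborel"
    "(\<lambda>(x, y). k x y) \<in> borel_measurable (lborel \<Otimes>\<^sub>M lborel)" for x
    unfolding k_def by measurable
  have k_indicator: "k x y = indicator {x - \<xi>/2..x + \<xi>/2} y" "k x y = indicator {y - \<xi>/2..y + \<xi>/2} x" for x y
  proof -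
    have "\<bar>x - y\<bar> \<le> \<xi> / 2 \<longleftrightarrow> x - \<xi>/2 \<le> y \<and> y \<le> x + \<xi>/2" by arith
    moreover have "\<bar>x - y\<bar> \<le> \<xi> / 2 \<longleftrightarrow> y - \<xi>/2 \<le> x \<and> x \<le> y + \<xi>/2" by arith
    ultimately show "k x y = indicator {x - \<xi>/2..x + \<xi>/2} y" "k x y = indicator {y - \<xi>/2..y + \<xi>/2} x"
      by (simp_all add: k_def indicator_def)
  qed
  have k_integral: "(\<integral>\<^sup>+y. k x y \<partial>lborel) = ennreal \<xi>"
    "(\<integral>\<^sup>+x. k x y \<partial>lborel) = ennreal \<xi>" for x y
  proof -
    show "(\<integral>\<^sup>+y. k x y \<partial>lborel) = ennreal \<xi>"
      unfolding k_indicator(1) using assms(2) by simp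
    show "(\<integral>\<^sup>+x. k x y \<partial>lborel) = ennreal \<xi>"
      unfolding k_indicator(2) using assms(2) by simp
  qed
  have pointwise: "ennreal ((\<A> \<xi> W x)\<^sup>2) \<le> ennreal \<xi> * (\<integral>\<^sup>+y. k x y * ennreal ((V y)\<^sup>2) \<partial>lborel)" for x
  proof -
    have "ennreal \<bar>\<A> \<xi> W x\<bar> \<le> (\<integral>\<^sup>+y. ennreal (norm (indicat_real {x - \<xi>/2..x + \<xi>/2} y *\<^sub>R W y)) \<partial>lebesgue)"
      unfolding \<A>_def set_lebesgue_integral_def
      using integral_norm_bound_ennreal[of lebesgue "\<lambda>y. indicat_real {x - \<xi>/2..x + \<xi>/2} y *\<^sub>R W y"]
      by (cases "integrable lebesgue (\<lambda>y. indicat_real {x - \<xi>/2..x + \<xi>/2} y *\<^sub>R W y)")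
        (auto simp: not_integrable_integral_eq)
    also have "\<dots> = (\<integral>\<^sup>+y. k x y * ennreal \<bar>V y\<bar> \<partial>lebesgue)"
      using V by (intro nn_integral_cong_AE) (auto elim!: eventually_mono simp: k_indicator(1) indicator_def)
    also have "\<dots> = (\<integral>\<^sup>+y. k x y * (k x y * ennreal \<bar>V y\<bar>) \<partial>lborel)"
      by (auto simp: nn_integral_completion k_def intro!: nn_integral_cong)
    finally have "(ennreal \<bar>\<A> \<xi> W x\<bar>)\<^sup>2 \<le> (\<integral>\<^sup>+y. k x y * (k x y * ennreal \<bar>V y\<bar>) \<partial>lborel)\<^sup>2"
      by (rule power_mono) simp
    also have "\<dots> \<le> (\<integral>\<^sup>+y. k x y ^ 2 \<partial>lborel) * (\<integral>\<^sup>+y. (k x y * ennreal \<bar>V y\<bar>) ^ 2 \<partial>lborel)"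
      by (rule Cauchy_Schwarz_nn_integral) measurable
    also have "(\<integral>\<^sup>+y. k x y ^ 2 \<partial>lborel) = (\<integral>\<^sup>+y. k x y \<partial>lborel)"
      by (intro nn_integral_cong) (simp add: k_def)
    also have "(\<integral>\<^sup>+y. (k x y * ennreal \<bar>V y\<bar>) ^ 2 \<partial>lborel) = (\<integral>\<^sup>+y. k x y * ennreal ((V y)\<^sup>2) \<partial>lborel)"
      by (intro nn_integral_cong) (simp add: k_def ennreal_power)
    finally show ?thesis by (simp add: k_integral ennreal_power)
  qed
  have "(\<integral>\<^sup>+x. ennreal ((\<A> \<xi> W x)\<^sup>2) \<partial>lebesgue)
      \<le> (\<integral>\<^sup>+x. ennreal \<xi> * (\<integral>\<^sup>+y. k x y * ennreal ((V y)\<^sup>2) \<partial>lborel) \<partial>lborel)"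
    unfolding nn_integral_completion by (intro nn_integral_mono pointwise)
  also have "\<dots> = ennreal \<xi> * (\<integral>\<^sup>+x. \<integral>\<^sup>+y. k x y * ennreal ((V y)\<^sup>2) \<partial>lborel \<partial>lborel)"
    by (rule nn_integral_cmult) measurable
  also have "(\<integral>\<^sup>+x. \<integral>\<^sup>+y. k x y * ennreal ((V y)\<^sup>2) \<partial>lborel \<partial>lborel)
      = (\<integral>\<^sup>+y. \<integral>\<^sup>+x. k x y * ennreal ((V y)\<^sup>2) \<partial>lborel \<partial>lborel)"
    by (rule lborel_pair.Fubini'[symmetric]) measurable
  also have "\<dots> = (\<integral>\<^sup>+y. ennreal \<xi> * ennreal ((V y)\<^sup>2) \<partial>lborel)"
  proof (intro nn_integral_cong)
    fix y
    have "(\<lambda>x. k x y) \<in> borel_measurable lborel" unfolding k_def by measurable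
    then show "(\<integral>\<^sup>+x. k x y * ennreal ((V y)\<^sup>2) \<partial>lborel) = ennreal \<xi> * ennreal ((V y)\<^sup>2)"
      by (subst nn_integral_multc) (simp_all add: k_integral)
  qed
  also have "\<dots> = ennreal \<xi> * (\<integral>\<^sup>+y. ennreal ((V y)\<^sup>2) \<partial>lborel)"
    by (rule nn_integral_cmult) measurable
  also have "(\<integral>\<^sup>+y. ennreal ((V y)\<^sup>2) \<partial>lborel) = (\<integral>\<^sup>+y. ennreal ((V y)\<^sup>2) \<partial>lebesgue)"
    by (simp add: nn_integral_completion)
  also have "\<dots> = (\<integral>\<^sup>+y. ennreal ((W y)\<^sup>2) \<partial>lebesgue)"
    using V by (intro nn_integral_cong_AE) (auto elim!: eventually_mono)
  also have "\<dots> = ennreal ((L2_norm W)\<^sup>2)"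
    using W(2) by (subst nn_integral_eq_integral) (auto simp: L2_norm_def)
  finally show ?thesis
    using assms(2) by (simp add: ennreal_mult power2_eq_square mult.assoc)
qed

text \<open>
  The complement of the essential support is a union of open sets on each of which \<open>f\<close> vanishes almost
  everywhere; by Lindelof's theorem countably many of them suffice.
\<close>

lemma AE_zero_outside_ess_support:
  assumes "ess_support S f \<subseteq> T"
  shows "AE y in lebesgue_on S. y \<notin> T \<longrightarrow> f y = 0"
proof -
  define F where "F = {B. open B \<and> (AE y in lebesgue_on S. y \<in> B \<longrightarrow> f y = 0)}"
  obtain G where G: "G \<subseteq> F" "countable G" "\<Union>G = \<Union>F"
    by (rule Lindelof[of F]) (auto simp: F_def)
  have "AE y in lebesgue_on S. \<forall>B\<in>G. y \<in> B \<longrightarrow> f y = 0"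
    using G by (intro AE_ball_countable') (auto simp: F_def)
  moreover have "\<exists>B\<in>G. y \<in> B" if "y \<notin> T" for y
  proof -
    have "y \<notin> ess_support S f" using assms that by blast
    then obtain e where "e > 0" "AE z in lebesgue_on S. z \<in> ball y e \<longrightarrow> f z = 0"
      by (auto simp: ess_support_def)
    then have "ball y e \<in> F" "y \<in> ball y e" by (auto simp: F_def)
    then show ?thesis using G(3) by blast
  qed
  ultimately show ?thesis by (auto elim!: eventually_mono)
qed

lemma averaging_step_plateau:
  assumes "0 \<le> \<xi>" "\<bar>x\<bar> \<le> L - \<xi> / 2"
  shows "\<A> \<xi> (step h L) x = h * \<xi>"
proof -
  have "indicat_real {x - \<xi>/2..x + \<xi>/2} y *\<^sub>R step h L y = h * indicat_real {x - \<xi>/2..x + \<xi>/2} y" for y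
    using assms by (auto simp: step_def indicator_def abs_le_iff)
  then have "\<A> \<xi> (step h L) x = (LINT y|lebesgue. h * indicat_real {x - \<xi>/2..x + \<xi>/2} y)"
    unfolding \<A>_def set_lebesgue_integral_def by presburger
  then show ?thesis using assms(1) by simp
qed

text \<open>
  Windows centred within \<open>L - \<xi>/2\<close> of the origin lie inside the step, so the average is constant there;
  the two boundary layers outside are discarded.
\<close>

lemma nn_integral_averaged_step_ge:
  assumes "0 \<le> \<xi>" "\<xi> \<le> 2 * L"
  shows "ennreal ((2 * L - \<xi>) * G (h * \<xi>)) \<le> (\<integral>\<^sup>+x. ennreal (G (\<A> \<xi> (step h L) x)) \<partial>lebesgue)"
proof -
  let ?I = "{-(L - \<xi>/2)..L - \<xi>/2}"
  have "ennreal ((2 * L - \<xi>) * G (h * \<xi>)) = (\<integral>\<^sup>+x. ennreal (G (h * \<xi>)) * indicator ?I x \<partial>lebesgue)"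
    using assms by (simp add: nn_integral_cmult_indicator ennreal_mult'' mult.commute[of "2 * L - \<xi>"] del: mult.commute)
  also have "\<dots> \<le> (\<integral>\<^sup>+x. ennreal (G (\<A> \<xi> (step h L) x)) \<partial>lebesgue)"
    using assms averaging_step_plateau[of \<xi> _ L h]
    by (intro nn_integral_mono) (auto simp: indicator_def abs_le_iff)
  finally show ?thesis .
qed

section \<open>Comparison of the two suprema\<close>

lemma Q_le:
  assumes "W \<in> L2" and "\<And>\<xi>. 0 < \<xi> \<Longrightarrow> 0 \<le> \<alpha> \<xi>" and "0 \<le> (hderiv ^^ 2) \<Phi> 0"
    and int: "integrable (lebesgue_on {0<..}) (\<lambda>\<xi>. \<alpha> \<xi> * (\<beta> \<xi>)\<^sup>2 * \<xi>\<^sup>2)"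
  shows "\<Q> \<Phi> \<alpha> \<beta> W \<le> ennreal (1/2 * (hderiv ^^ 2) \<Phi> 0 *
    ((L2_norm W)\<^sup>2 * (LINT \<xi>|lebesgue_on {0<..}. \<alpha> \<xi> * (\<beta> \<xi>)\<^sup>2 * \<xi>\<^sup>2)))"
proof -
  have "(\<integral>\<^sup>+\<xi>. ennreal (\<alpha> \<xi> * (\<beta> \<xi>)\<^sup>2) * (\<integral>\<^sup>+x. ennreal ((\<A> \<xi> W x)\<^sup>2) \<partial>lebesgue) \<partial>lebesgue_on {0<..})
      \<le> (\<integral>\<^sup>+\<xi>. ennreal ((L2_norm W)\<^sup>2 * (\<alpha> \<xi> * (\<beta> \<xi>)\<^sup>2 * \<xi>\<^sup>2)) \<partial>lebesgue_on {0<..})"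
  proof (rule nn_integral_mono)
    fix \<xi> :: real assume "\<xi> \<in> space (lebesgue_on {0<..})"
    then have "0 < \<xi>" by simp
    then have "ennreal (\<alpha> \<xi> * (\<beta> \<xi>)\<^sup>2) * (\<integral>\<^sup>+x. ennreal ((\<A> \<xi> W x)\<^sup>2) \<partial>lebesgue)
        \<le> ennreal (\<alpha> \<xi> * (\<beta> \<xi>)\<^sup>2) * ennreal (\<xi>\<^sup>2 * (L2_norm W)\<^sup>2)"
      using assms(1) by (intro mult_left_mono averaging_L2_bound) auto
    also have "\<dots> = ennreal ((L2_norm W)\<^sup>2 * (\<alpha> \<xi> * (\<beta> \<xi>)\<^sup>2 * \<xi>\<^sup>2))"
      by (subst ennreal_mult''[symmetric]) (simp_all add: mult_ac)
    finally show "ennreal (\<alpha> \<xi> * (\<beta> \<xi>)\<^sup>2) * (\<integral>\<^sup>+x. ennreal ((\<A> \<xi> W x)\<^sup>2) \<partial>lebesgue)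
        \<le> ennreal ((L2_norm W)\<^sup>2 * (\<alpha> \<xi> * (\<beta> \<xi>)\<^sup>2 * \<xi>\<^sup>2))" .
  qed
  also have "\<dots> = ennreal ((L2_norm W)\<^sup>2 * (LINT \<xi>|lebesgue_on {0<..}. \<alpha> \<xi> * (\<beta> \<xi>)\<^sup>2 * \<xi>\<^sup>2))"
    using assms(2) integrable_mult_right[OF int] by (subst nn_integral_eq_integral) (auto intro!: AE_I2)
  finally show ?thesis
    unfolding \<Q>_def using assms(3) by (subst ennreal_mult') (auto intro!: mult_left_mono)
qed

theorem proposition9:
  fixes \<Phi> \<alpha> \<beta> :: "real \<Rightarrow> real" and \<Xi> K :: real
  assumes "admissible \<Phi> \<alpha> \<beta>"
    and "(hderiv ^^ 3) \<Phi> 0 > 0"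
    and "0 < \<Xi>" and "ess_support {0<..} \<alpha> \<subseteq> {0..\<Xi>}"
    and "K > 0" and "\<C>_energy \<Phi> \<alpha> \<beta> K \<noteq> {}"
  shows "P_sup \<Phi> \<alpha> \<beta> K > Q_sup \<Phi> \<alpha> \<beta> K"
proof -
  define c2 c3 where "c2 = (hderiv ^^ 2) \<Phi> 0" and "c3 = (hderiv ^^ 3) \<Phi> 0"
  obtain W0 where W0: "W0 \<in> \<C>_energy \<Phi> \<alpha> \<beta> K" using assms(6) by blast
  then have P_W0: "0 < \<P> \<Phi> \<alpha> \<beta> W0" by (simp add: \<C>_energy_def)
  show ?thesis
  proof (cases "c2 \<le> 0")
    case True
    then have "Q_sup \<Phi> \<alpha> \<beta> K \<le> 0"
      unfolding Q_sup_def by (intro SUP_least) (simp add: \<Q>_def c2_def ennreal_neg)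
    also have "0 < \<P> \<Phi> \<alpha> \<beta> W0" by (rule P_W0)
    also have "\<dots> \<le> P_sup \<Phi> \<alpha> \<beta> K" unfolding P_sup_def by (rule SUP_upper[OF W0])
    finally show ?thesis .
  next
    case False
    then have "0 < c2" by simp
    let ?M = "lebesgue_on {0::real<..}"
    have wsq: "weakly_super_quadratic \<Phi>" and C3: "C3_halfline \<Phi>"
      and [measurable]: "\<alpha> \<in> borel_measurable ?M" "\<beta> \<in> borel_measurable ?M"
      and \<alpha>: "\<And>\<xi>. 0 < \<xi> \<Longrightarrow> 0 \<le> \<alpha> \<xi>" and \<beta>: "\<And>\<xi>. 0 < \<xi> \<Longrightarrow> 0 \<le> \<beta> \<xi>"
      and finite: "(\<integral>\<^sup>+\<xi>. ennreal ((\<xi> + \<xi>\<^sup>2) * \<alpha> \<xi> * (\<beta> \<xi>)\<^sup>2 *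
        small_phi \<Phi> (sqrt \<xi> * \<beta> \<xi> * sqrt (2 * K))) \<partial>?M) < \<infinity>"
      using assms(1,5) by (auto simp: admissible_def)
    have [measurable]: "(\<lambda>\<xi>. \<xi>) \<in> borel_measurable ?M"
      by (intro measurable_restrict_space1 measurable_completion) simp
    \<comment> \<open>Weights of the quadratic and cubic parts of the energy. The truncation at \<open>N\<close> makes the cubic
      weight integrable and keeps the arguments \<open>\<beta> \<xi> h \<xi>\<close> of \<open>\<Phi>\<close> uniformly small as \<open>h\<close> tends to \<open>0\<close>.\<close>
    define quad_wt where "quad_wt \<xi> = \<alpha> \<xi> * (\<beta> \<xi>)\<^sup>2 * \<xi>\<^sup>2" for \<xi>
    define cub_wt where "cub_wt N \<xi> = (if \<beta> \<xi> * \<xi> \<le> real N then quad_wt \<xi> * (\<beta> \<xi> * \<xi>) else 0)" for N \<xi>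
    have [measurable]: "quad_wt \<in> borel_measurable ?M" unfolding quad_wt_def by measurable
    have [measurable]: "cub_wt N \<in> borel_measurable ?M" for N unfolding cub_wt_def by measurable
    have quad_wt_nonneg: "0 \<le> quad_wt \<xi>" if "0 < \<xi>" for \<xi> using \<alpha>[OF that] by (simp add: quad_wt_def)
    have cub_wt_nonneg: "0 \<le> cub_wt N \<xi>" if "0 < \<xi>" for N \<xi>
      using quad_wt_nonneg[OF that] \<beta>[OF that] that by (simp add: cub_wt_def)

    have quad_wt_int: "integrable ?M quad_wt"
    proof -
      have "ennreal c2 * (\<integral>\<^sup>+\<xi>. ennreal (quad_wt \<xi>) \<partial>?M) = (\<integral>\<^sup>+\<xi>. ennreal (c2 * quad_wt \<xi>) \<partial>?M)"
        using \<open>0 < c2\<close> by (subst nn_integral_cmult[symmetric]) (simp_all add: ennreal_mult')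
      also have "\<dots> \<le> (\<integral>\<^sup>+\<xi>. ennreal ((\<xi> + \<xi>\<^sup>2) * \<alpha> \<xi> * (\<beta> \<xi>)\<^sup>2 *
          small_phi \<Phi> (sqrt \<xi> * \<beta> \<xi> * sqrt (2 * K))) \<partial>?M)"
      proof (intro nn_integral_mono ennreal_leI)
        fix \<xi> assume "\<xi> \<in> space ?M"
        then have "0 < \<xi>" by simp
        have "quad_wt \<xi> \<le> (\<xi> + \<xi>\<^sup>2) * \<alpha> \<xi> * (\<beta> \<xi>)\<^sup>2"
          using \<alpha>[OF \<open>0 < \<xi>\<close>] \<open>0 < \<xi>\<close> by (simp add: quad_wt_def algebra_simps)
        moreover have "c2 \<le> small_phi \<Phi> (sqrt \<xi> * \<beta> \<xi> * sqrt (2 * K))"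
          unfolding c2_def using \<open>0 < \<xi>\<close> \<beta> assms(5) by (intro small_phi_ge[OF wsq C3]) auto
        ultimately have "quad_wt \<xi> * c2 \<le> (\<xi> + \<xi>\<^sup>2) * \<alpha> \<xi> * (\<beta> \<xi>)\<^sup>2 *
            small_phi \<Phi> (sqrt \<xi> * \<beta> \<xi> * sqrt (2 * K))"
          using \<open>0 < c2\<close> \<open>0 < \<xi>\<close> \<alpha>[OF \<open>0 < \<xi>\<close>] by (intro mult_mono) auto
        then show "c2 * quad_wt \<xi> \<le> (\<xi> + \<xi>\<^sup>2) * \<alpha> \<xi> * (\<beta> \<xi>)\<^sup>2 *
            small_phi \<Phi> (sqrt \<xi> * \<beta> \<xi> * sqrt (2 * K))" by (simp add: mult.commute)
      qed
      also have "\<dots> < \<infinity>" by (rule finite)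
      finally have "(\<integral>\<^sup>+\<xi>. ennreal (quad_wt \<xi>) \<partial>?M) < \<infinity>"
        using \<open>0 < c2\<close> by (auto simp: ennreal_mult_less_top)
      then show ?thesis
        using quad_wt_nonneg by (intro integrableI_nonneg) (auto intro!: AE_I2)
    qed
    have cub_wt_int: "integrable ?M (cub_wt N)" for N
    proof (rule Bochner_Integration.integrable_bound)
      show "integrable ?M (\<lambda>\<xi>. real N * quad_wt \<xi>)" using quad_wt_int by simp
      show "AE \<xi> in ?M. norm (cub_wt N \<xi>) \<le> norm (real N * quad_wt \<xi>)"
      proof (rule AE_I2)
        fix \<xi> assume "\<xi> \<in> space ?M"
        then have "0 < \<xi>" by simp
        have "cub_wt N \<xi> \<le> real N * quad_wt \<xi>"
          using quad_wt_nonneg[OF \<open>0 < \<xi>\<close>] by (auto simp: cub_wt_def mult.commute[of "quad_wt \<xi>"] intro: mult_right_mono)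
        then show "norm (cub_wt N \<xi>) \<le> norm (real N * quad_wt \<xi>)"
          using quad_wt_nonneg[OF \<open>0 < \<xi>\<close>] cub_wt_nonneg[OF \<open>0 < \<xi>\<close>] by simp
      qed
    qed measurable

    \<comment> \<open>Otherwise \<open>\<alpha>\<beta>\<close> would vanish almost everywhere and no profile would have positive energy.\<close>
    obtain N where N: "0 < (LINT \<xi>|?M. cub_wt N \<xi>)"
    proof (rule ccontr)
      assume "\<not> thesis"
      then have "\<not> 0 < (LINT \<xi>|?M. cub_wt N \<xi>)" for N using that by blast
      moreover have "0 \<le> (LINT \<xi>|?M. cub_wt N \<xi>)" for N
        using cub_wt_nonneg by (intro integral_nonneg_AE AE_I2) simp
      ultimately have "(LINT \<xi>|?M. cub_wt N \<xi>) = 0" for N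
        by (meson order_antisym_conv not_less)
      then have "AE \<xi> in ?M. cub_wt N \<xi> = 0" for N
        using cub_wt_nonneg integral_nonneg_eq_0_iff_AE[OF cub_wt_int[of N]]
        by (metis (no_types, lifting) AE_I2 greaterThan_iff space_lebesgue_on)
      then have "AE \<xi> in ?M. \<forall>N. cub_wt N \<xi> = 0" by (simp add: AE_all_countable)
      then have "AE \<xi> in ?M. \<alpha> \<xi> = 0 \<or> \<beta> \<xi> = 0"
        using AE_space
      proof eventually_elim
        case (elim \<xi>)
        obtain n where "\<beta> \<xi> * \<xi> \<le> real n" using real_arch_simple by blast
        then have "quad_wt \<xi> * (\<beta> \<xi> * \<xi>) = 0" using elim(1) by (metis cub_wt_def)
        then show ?case using elim(2) by (auto simp: quad_wt_def)
      qed
      then have "\<P> \<Phi> \<alpha> \<beta> W0 = (\<integral>\<^sup>+\<xi>. 0 \<partial>?M)"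
        unfolding \<P>_def using Phi_zero(1)[OF wsq C3]
        by (intro nn_integral_cong_AE) (auto elim!: eventually_mono)
      then show False using P_W0 by simp
    qed
    define A G where "A = (LINT \<xi>|?M. quad_wt \<xi>)" and "G = (LINT \<xi>|?M. cub_wt N \<xi>)"
    have "0 \<le> A" unfolding A_def using quad_wt_nonneg by (intro integral_nonneg_AE AE_I2) simp
    have "0 < G" using N by (simp add: G_def)
    have "0 < c3" using assms(2) by (simp add: c3_def)

    obtain r0 where "0 < r0"
      and cubic: "\<And>r. 0 \<le> r \<Longrightarrow> r \<le> r0 \<Longrightarrow> c2 / 2 * r\<^sup>2 + c3 / 12 * r ^ 3 \<le> \<Phi> r"
      using Phi_ge_cubic_near_zero[OF wsq C3 assms(2)] unfolding c2_def c3_def by blast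
    have quadratic: "c2 / 2 * r\<^sup>2 \<le> \<Phi> r" if "0 \<le> r" for r
      using Phi_ge_quadratic[OF wsq C3 that] by (simp add: c2_def)

    \<comment> \<open>The requirements on \<open>h\<close>: the cubic bound applies on the truncated set, the boundary layers are
      shorter than the step (\<open>\<Xi> < L\<close>), and the cubic gain exceeds the boundary loss after division by \<open>h\<close>.\<close>
    have "\<forall>\<^sub>F h in at_right 0. h * real N < r0"
      by (rule order_tendstoD(2)[of _ "0 * real N"]) (use \<open>0 < r0\<close> in \<open>auto intro!: tendsto_eq_intros\<close>)
    moreover have "\<forall>\<^sub>F h in at_right 0. h\<^sup>2 * \<Xi> < K"
      by (rule order_tendstoD(2)[of _ "0\<^sup>2 * \<Xi>"]) (use assms(5) in \<open>auto intro!: tendsto_eq_intros\<close>)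
    moreover have "\<forall>\<^sub>F h in at_right 0. h * (c2 * \<Xi> * A / 2) < c3 / 12 * K * G"
      by (rule order_tendstoD(2)[of _ "0 * (c2 * \<Xi> * A / 2)"])
        (use \<open>0 < c3\<close> \<open>0 < G\<close> assms(5) in \<open>auto intro!: tendsto_eq_intros\<close>)
    moreover have "\<forall>\<^sub>F h in at_right 0. 0 < (h::real)" by (rule eventually_at_right_less)
    ultimately have "\<forall>\<^sub>F h in at_right 0. h * real N < r0 \<and> h\<^sup>2 * \<Xi> < K \<and>
        h * (c2 * \<Xi> * A / 2) < c3 / 12 * K * G \<and> 0 < h"
      by (intro eventually_conj)
    then obtain h where h: "h * real N < r0" "h\<^sup>2 * \<Xi> < K"
        "h * (c2 * \<Xi> * A / 2) < c3 / 12 * K * G" "0 < h"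
      using eventually_happens[of _ "at_right (0::real)"] by auto
    define L where "L = K / h\<^sup>2"
    have hL: "h\<^sup>2 * L = K" using h(4) by (simp add: L_def)
    have "\<Xi> < L" using h(2,4) by (simp add: L_def field_simps)
    then have "0 < L" using assms(3) by simp

    \<comment> \<open>The energy of the step is at least \<open>a A + b G\<close>. In \<open>a\<close> the plateau length is bounded below by
      \<open>2 L - \<Xi>\<close>, which shows the boundary loss; in \<open>b\<close> the crude bound \<open>L\<close> is enough.\<close>
    define a b where "a = c2 / 2 * h\<^sup>2 * (2 * L - \<Xi>)" and "b = c3 / 12 * h ^ 3 * L"
    have "0 \<le> a" "0 \<le> b"
      using \<open>0 < c2\<close> \<open>0 < c3\<close> \<open>\<Xi> < L\<close> \<open>0 < L\<close> h(4) by (auto simp: a_def b_def)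
    have pointwise: "a * quad_wt \<xi> + b * cub_wt N \<xi> \<le> (2 * L - \<xi>) * (\<alpha> \<xi> * \<Phi> (\<beta> \<xi> * (h * \<xi>)))"
      if "0 < \<xi>" "\<xi> \<le> \<Xi>" for \<xi>
    proof -
      define u v where "u = c2 / 2 * h\<^sup>2 * quad_wt \<xi>" and "v = c3 / 12 * h ^ 3 * cub_wt N \<xi>"
      have uv: "0 \<le> u" "0 \<le> v"
        using quad_wt_nonneg[OF that(1)] cub_wt_nonneg[OF that(1)] \<open>0 < c2\<close> \<open>0 < c3\<close> h(4)
        by (auto simp: u_def v_def)
      define r where "r = \<beta> \<xi> * (h * \<xi>)"
      have "0 \<le> r" using \<beta>[OF that(1)] that h(4) by (simp add: r_def)
      have "u + v \<le> \<alpha> \<xi> * \<Phi> r"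
      proof (cases "\<beta> \<xi> * \<xi> \<le> real N")
        case True
        then have "h * (\<beta> \<xi> * \<xi>) \<le> h * real N" using h(4) by (intro mult_left_mono) auto
        then have "r \<le> r0" using h(1) by (simp add: r_def mult_ac)
        have "u + v = \<alpha> \<xi> * (c2 / 2 * r\<^sup>2 + c3 / 12 * r ^ 3)"
          using True by (simp add: u_def v_def quad_wt_def cub_wt_def r_def power_mult_distrib
              power2_eq_square power3_eq_cube algebra_simps)
        also have "\<dots> \<le> \<alpha> \<xi> * \<Phi> r"
          using cubic[OF \<open>0 \<le> r\<close> \<open>r \<le> r0\<close>] \<alpha>[OF that(1)] by (intro mult_left_mono) auto
        finally show ?thesis .
      next
        case False
        then have "u + v = \<alpha> \<xi> * (c2 / 2 * r\<^sup>2)"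
          by (simp add: u_def v_def quad_wt_def cub_wt_def r_def power_mult_distrib)
        also have "\<dots> \<le> \<alpha> \<xi> * \<Phi> r"
          using quadratic[OF \<open>0 \<le> r\<close>] \<alpha>[OF that(1)] by (intro mult_left_mono) auto
        finally show ?thesis .
      qed
      have "a * quad_wt \<xi> + b * cub_wt N \<xi> = (2 * L - \<Xi>) * u + L * v"
        by (simp add: a_def b_def u_def v_def mult_ac)
      also have "\<dots> \<le> (2 * L - \<xi>) * u + (2 * L - \<xi>) * v"
        using uv that \<open>\<Xi> < L\<close> by (intro add_mono mult_right_mono) auto
      also have "\<dots> = (2 * L - \<xi>) * (u + v)" by (simp add: algebra_simps)
      also have "\<dots> \<le> (2 * L - \<xi>) * (\<alpha> \<xi> * \<Phi> r)"
        using \<open>u + v \<le> _\<close> that \<open>\<Xi> < L\<close> by (intro mult_left_mono) auto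
      finally show ?thesis by (simp add: r_def)
    qed

    have P_step: "ennreal (a * A + b * G) \<le> \<P> \<Phi> \<alpha> \<beta> (step h L)"
    proof -
      have "a * A + b * G = (LINT \<xi>|?M. a * quad_wt \<xi> + b * cub_wt N \<xi>)"
        using quad_wt_int cub_wt_int by (simp add: A_def G_def)
      then have "ennreal (a * A + b * G) = (\<integral>\<^sup>+\<xi>. ennreal (a * quad_wt \<xi> + b * cub_wt N \<xi>) \<partial>?M)"
        using quad_wt_int cub_wt_int quad_wt_nonneg cub_wt_nonneg \<open>0 \<le> a\<close> \<open>0 \<le> b\<close>
        by (subst nn_integral_eq_integral) (auto intro!: AE_I2)
      also have "\<dots> \<le> \<P> \<Phi> \<alpha> \<beta> (step h L)"
        unfolding \<P>_def
      proof (rule nn_integral_mono_AE)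
        show "AE \<xi> in ?M. ennreal (a * quad_wt \<xi> + b * cub_wt N \<xi>)
            \<le> (\<integral>\<^sup>+x. ennreal (\<alpha> \<xi> * \<Phi> (\<beta> \<xi> * \<A> \<xi> (step h L) x)) \<partial>lebesgue)"
          using AE_zero_outside_ess_support[OF assms(4)] AE_space
        proof eventually_elim
          case (elim \<xi>)
          then have "0 < \<xi>" by simp
          show ?case
          proof (cases "\<xi> \<le> \<Xi>")
            case True
            then have "ennreal (a * quad_wt \<xi> + b * cub_wt N \<xi>)
                \<le> ennreal ((2 * L - \<xi>) * (\<alpha> \<xi> * \<Phi> (\<beta> \<xi> * (h * \<xi>))))"
              using pointwise \<open>0 < \<xi>\<close> by (intro ennreal_leI) auto
            also have "\<dots> \<le> (\<integral>\<^sup>+x. ennreal (\<alpha> \<xi> * \<Phi> (\<beta> \<xi> * \<A> \<xi> (step h L) x)) \<partial>lebesgue)"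
              using True \<open>0 < \<xi>\<close> \<open>\<Xi> < L\<close> \<open>0 < L\<close>
              by (intro nn_integral_averaged_step_ge[where G = "\<lambda>s. \<alpha> \<xi> * \<Phi> (\<beta> \<xi> * s)"]) auto
            finally show ?thesis .
          next
            case False
            then have "\<alpha> \<xi> = 0" using elim(1) by simp
            then show ?thesis by (simp add: quad_wt_def cub_wt_def)
          qed
        qed
      qed
      finally show ?thesis .
    qed

    have "c2 * K * A < a * A + b * G"
    proof -
      have "a = c2 * (h\<^sup>2 * L) - h * h * (c2 * \<Xi> / 2)"
        by (simp add: a_def power2_eq_square field_simps)
      then have "a = c2 * K - h * h * (c2 * \<Xi> / 2)" by (simp only: hL)
      moreover have "b = h * (c3 / 12 * (h\<^sup>2 * L))"
        by (simp add: b_def power2_eq_square power3_eq_cube)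
      then have "b = h * (c3 / 12 * K)" by (simp only: hL)
      ultimately have gain: "a * A + b * G
          = c2 * K * A - h * (h * (c2 * \<Xi> * A / 2)) + h * (c3 / 12 * K * G)"
        by (simp only:) (simp add: algebra_simps)
      have "h * (h * (c2 * \<Xi> * A / 2)) < h * (c3 / 12 * K * G)"
        using h(3,4) by (rule mult_strict_left_mono)
      then show ?thesis unfolding gain by linarith
    qed
    moreover have "0 \<le> c2 * K * A" using \<open>0 < c2\<close> \<open>0 \<le> A\<close> assms(5) by simp
    ultimately have gap: "ennreal (c2 * K * A) < \<P> \<Phi> \<alpha> \<beta> (step h L)"
      using P_step by (meson ennreal_lessI order_less_le_trans order_le_less_trans)
    have "step h L \<in> \<C>" using \<open>0 < L\<close> h(4) by (intro step_in_closed_cone) auto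
    moreover have "\<K> (step h L) = K"
      using integral_step_squared(2)[of L h] \<open>0 < L\<close> hL by (simp add: \<K>_def L2_norm_def mult_ac)
    moreover have "0 < \<P> \<Phi> \<alpha> \<beta> (step h L)" using gap by (rule le_less_trans[rotated]) simp
    ultimately have "step h L \<in> \<C>_energy \<Phi> \<alpha> \<beta> K" by (simp add: \<C>_energy_def)
    then have "\<P> \<Phi> \<alpha> \<beta> (step h L) \<le> P_sup \<Phi> \<alpha> \<beta> K" unfolding P_sup_def by (rule SUP_upper)
    moreover have "Q_sup \<Phi> \<alpha> \<beta> K \<le> ennreal (c2 * K * A)"
      unfolding Q_sup_def
    proof (rule SUP_least)
      fix W assume "W \<in> \<C>_energy \<Phi> \<alpha> \<beta> K"
      then have "W \<in> L2" and "(L2_norm W)\<^sup>2 = 2 * K" by (auto simp: \<C>_energy_def \<C>_def \<K>_def)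
      then show "\<Q> \<Phi> \<alpha> \<beta> W \<le> ennreal (c2 * K * A)"
        using Q_le[of W \<alpha> \<Phi> \<beta>] \<alpha> \<open>0 < c2\<close> quad_wt_int
        unfolding A_def quad_wt_def c2_def by (simp add: mult_ac)
    qed
    ultimately show ?thesis using gap by (meson order_less_le_trans order_le_less_trans)
  qed
qed

end
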